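(* Let $(\Gamma,\alpha)$ be an abstract one-skeleton, $\xi\in\mathfrak g$ a generic and polarizing vector such that $(\Gamma,\alpha)$ is $\xi$-acyclic, $\phi:V\to\mathbb R$ an injective $\xi$-compatible function, and $c\in\mathbb R\setminus\phi(V)$ a regular value of $\phi$. A map $f:V_c\to\mathbb S(\mathfrak g_\xi^* )$ is in $H(\Gamma_c,\alpha_c)$ if and only if, for every hyperedge $E$ of the hypergraph $\Gamma_c$, the restriction $f|_E$ is in $H(E,\alpha_c)$.
   Context: $\Gamma$ is a finite $d$-valent graph with vertex set $V$ and set of oriented edges $E_\Gamma$. For $e\in E_\Gamma$, $\bar e$ is $e$ reversed, $i(e)$, $t(e)$ are its initial and terminal vertices; $E_p=\{e:i(e)=p\}$ has $d$ elements. $\mathfrak g^*$ is a real vector space of dimension $n>1$ with dual $\mathfrak g$; $\mathbb S(\cdot)$ denotes the symmetric algebra. Abstract one-skeleton: a pair $(\Gamma,\alpha)$, $\alpha:E_\Gamma\to\mathfrak g^*$, with (A1) for each $p$ the vectors $\alpha_e$, $e\in E_p$, are pairwise linearly independent; (A2) $\alpha_{\bar e}=-\alpha_e$; (A3) for each $e$ with $p=i(e)$, $p'=t(e)$ one can order $E_p=\{e_1,\dots,e_d\}$, $E_{p'}=\{e_1',\dots,e_d'\}$ with $e_d=e$, $e_d'=\bar e$ and $\alpha_{e_i'}=\alpha_{e_i}+c_{i,e}\alpha_e$, $c_{i,e}\in\mathbb R$. $\xi$ is polarizing if $\alpha_e(\xi)\neq0$ for all $e$; generic if for every $p$ and $e_1,\dots,e_4\in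 E_p$ with $e_1\ne e_2$, $e_3\ne e_4$, $(e_1,e_2)\ne(e_3,e_4)$: $\frac{\alpha_{e_1}}{\alpha_{e_1}(\xi)}-\frac{\alpha_{e_2}}{\alpha_{e_2}(\xi)}\ne\frac{\alpha_{e_3}}{\alpha_{e_3}(\xi)}-\frac{\alpha_{e_4}}{\alpha_{e_4}(\xi)}$. $(\Gamma,\alpha)$ is $\xi$-acyclic if the orientation of $\Gamma$ by the edges with $\alpha_e(\xi)>0$ has no oriented cycles; $\phi$ is $\xi$-compatible if $\phi(i(e))<\phi(t(e))$ whenever $\alpha_e(\xi)>0$. $H(\Gamma,\alpha)$ is the ring of maps $f:V\to\mathbb S(\mathfrak g^* )$ with $f_{i(e)}\equiv f_{t(e)}\pmod{\alpha_e}$ for all $e\in E_\Gamma$. Cross-section: $V_c=\{e\in E_\Gamma:\phi(i(e))<c<\phi(t(e))\}$. Let $\mathfrak g_\xi^*=\{\gamma\in\mathfrak g^*:\gamma(\xi)=0\}$ and $Q(\mathfrak g_\xi^* )$ the quotient field of $\mathbb S(\mathfrak g_\xi^* )$. For $e\in V_c$ put $m_e=\alpha_e(\xi)>0$ and let $\rho_e:\mathbb S(\mathfrak g^* )\to\mathbb S(\mathfrak g_\xi^* )$ be the ring morphism induced by $\mathfrak g^*\to\mathfrak g_\xi^*$, $\gamma\mapsto\gamma-\frac{\gamma(\xi)}{\alpha_e(\xi)}\alpha_e$. The Kirwan map $\mathcal K_c:H(\Gamma,\alpha)\to\mathrm{Maps}(V_c,\mathbb S(\mathfrak g_\xi^*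 ))$ is $\mathcal K_c(h)(e)=\rho_e(h_{i(e)})=\rho_e(h_{t(e)})$. For $f:V_c\to Q(\mathfrak g_\xi^* )$ put $$\int_{\Gamma_c}f=\sum_{e\in V_c}\frac{f(e)}{m_e\prod_{e'\in E_{i(e)},\,e'\ne e}\rho_e(\alpha_{e'})}.$$ $H(\Gamma_c,\alpha_c)$ is the set of all $f:V_c\to Q(\mathfrak g_\xi^* )$ with $\int_{\Gamma_c}f\,\mathcal K_c(h)\in\mathbb S(\mathfrak g_\xi^* )$ for all $h\in H(\Gamma,\alpha)$. Hypergraph: for a subspace $\mathfrak h^*\subset\mathfrak g^*$, $\Gamma_{\mathfrak h^*}$ is the subgraph of $\Gamma$ whose edges are those $e$ with $\alpha_e\in\mathfrak h^*$. $\Gamma_c$ is the hypergraph with vertex set $V_c$ whose hyperedges are the (nonempty) sets $E=V_c(\Gamma^0_{\mathfrak h^*})$ of all edges of $\Gamma^0_{\mathfrak h^*}$ lying in $V_c$, where $\mathfrak h^*$ is a two-dimensional subspace of $\mathfrak g^*$ spanned by $\alpha_{e_1},\alpha_{e_2}$ for some $p\in V$ and $e_1,e_2\in E_p$, and $\Gamma^0_{\mathfrak h^*}$ is the connected component of $\Gamma_{\mathfrak h^*}$ containing $p$. $H(E,\alpha_c)$ is the module defined by the same construction from the one-skeleton $\Gamma^0=\Gamma_{\mathfrak h^*}^0$ in place of $\Gamma$ (keeping $\mathbb S(\mathfrak g^* )$ as coefficients): $H(\Gamma^0,\alpha)$ is the ring of maps $g:V_{\Gamma^0}\to\mathbb S(\mathfrak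 g^* )$ with $g_{i(e)}\equiv g_{t(e)}\pmod{\alpha_e}$ for all edges $e$ of $\Gamma^0$, $\mathcal K_c(g)(e)=\rho_e(g_{i(e)})$ for $e\in E$, $$\int_E f=\sum_{e\in E}\frac{f(e)}{m_e\prod\rho_e(\alpha_{e'})},$$ the product being over edges $e'\neq e$ of $\Gamma^0$ with $i(e')=i(e)$, and $H(E,\alpha_c)$ is the set of $f:E\to Q(\mathfrak g_\xi^* )$ with $\int_Ef\,\mathcal K_c(g)\in\mathbb S(\mathfrak g_\xi^* )$ for all $g\in H(\Gamma^0,\alpha)$. *)

theory Defs
  imports
    "HOL-Analysis.Analysis"
    "HOL-Library.Poly_Mapping"
    "HOL-Computational_Algebra.Fraction_Field"
    "Graph_Theory.Bidirected_Digraph"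
    "Graph_Theory.Arc_Walk"
    "Graph_Theory.Digraph_Component"
begin

section \<open>Symmetric algebras\<close>

text \<open>
  The \<open>n\<close>-dimensional space of weights (the dual of the Lie algebra) is \<open>real ^ 'n\<close>, and its
  symmetric algebra is the polynomial ring on its standard basis. The order on \<open>'n\<close> is needed only
  because the library derives the class \<open>idom\<close> for polynomial mappings from a monomial order.
  An element \<open>\<xi>\<close> of the dual of \<open>real ^ 'n\<close> is a linear functional, so that \<open>\<xi> \<gamma>\<close> is the pairing
  of a weight \<open>\<gamma>\<close> with \<open>\<xi>\<close>.
\<close>

type_synonym 'n weight = "(real, 'n) vec"
type_synonym 'n sym = "('n \<Rightarrow>\<^sub>0 nat) \<Rightarrow>\<^sub>0 real"

definition sconst :: "real \<Rightarrow> 'n::{finite,linorder} sym" where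
  "sconst a = Poly_Mapping.single 0 a"

definition slin :: "'n::{finite,linorder} weight \<Rightarrow> 'n sym" where
  "slin v = (\<Sum>i\<in>UNIV. Poly_Mapping.single (Poly_Mapping.single i 1) (v $ i))"

text \<open>
  For a subspace \<open>W\<close>, the symmetric algebra of \<open>W\<close> embeds in that of the whole space as the
  subalgebra generated by \<open>W\<close>; likewise its quotient field embeds in the big quotient field.
\<close>

inductive_set sym_of :: "'n::{finite,linorder} weight set \<Rightarrow> 'n sym set"
  for W :: "'n weight set" where
  const: "sconst a \<in> sym_of W"
| gen: "v \<in> W \<Longrightarrow> slin v \<in> sym_of W"
| add: "p \<in> sym_of W \<Longrightarrow> q \<in> sym_of W \<Longrightarrow> p + q \<in> sym_of W"
| mult: "p \<in> sym_of W \<Longrightarrow> q \<in> sym_of W \<Longrightarrow> p * q \<in> sym_of W"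

definition to_quot :: "'n::{finite,linorder} sym \<Rightarrow> 'n sym fract" where
  "to_quot p = Fraction_Field.Fract p 1"

definition quot_of :: "'n::{finite,linorder} weight set \<Rightarrow> 'n sym fract set" where
  "quot_of W = {to_quot p / to_quot q | p q. p \<in> sym_of W \<and> q \<in> sym_of W \<and> q \<noteq> 0}"

text \<open>The ring morphism induced by a linear map \<open>T\<close>: substitute \<open>T (axis i 1)\<close> for the
  \<open>i\<close>-th variable.\<close>

definition sym_map ::
  "('n::{finite,linorder} weight \<Rightarrow> 'n weight) \<Rightarrow> 'n sym \<Rightarrow> 'n sym" where
  "sym_map T p = (\<Sum>m\<in>Poly_Mapping.keys p.
     sconst (Poly_Mapping.lookup p m) * (\<Prod>i\<in>UNIV. slin (T (axis i 1)) ^ Poly_Mapping.lookup m i))"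

definition annihilator :: "('n::{finite,linorder} weight \<Rightarrow> real) \<Rightarrow> 'n weight set" where
  "annihilator \<xi> = {\<gamma>. \<xi> \<gamma> = 0}"

text \<open>The morphism \<open>\<rho>\<^sub>e\<close>, with \<open>a = \<alpha> e\<close>.\<close>

definition rho :: "('n::{finite,linorder} weight \<Rightarrow> real) \<Rightarrow> 'n weight \<Rightarrow> 'n sym \<Rightarrow> 'n sym" where
  "rho \<xi> a = sym_map (\<lambda>\<gamma>. \<gamma> - (\<xi> \<gamma> / \<xi> a) *\<^sub>R a)"

lemma sym_map_superset:
  assumes "finite A" "Poly_Mapping.keys p \<subseteq> A"
  shows "sym_map T p = (\<Sum>m\<in>A. sconst (Poly_Mapping.lookup p m) *
    (\<Prod>i\<in>UNIV. slin (T (axis i 1)) ^ Poly_Mapping.lookup m i))"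
  unfolding sym_map_def using assms
  by (intro sum.mono_neutral_left) (auto simp: sconst_def in_keys_iff)

lemma sym_map_add: "sym_map T (p + q) = sym_map T p + sym_map T q"
proof -
  let ?A = "Poly_Mapping.keys p \<union> Poly_Mapping.keys q"
  have "Poly_Mapping.keys (p + q) \<subseteq> ?A" by (rule Poly_Mapping.keys_add)
  then show ?thesis
    by (simp add: sym_map_superset[of ?A] lookup_add sconst_def single_add distrib_right
        sum.distrib)
qed

lemma sym_map_single:
  "sym_map T (Poly_Mapping.single m a) =
    sconst a * (\<Prod>i\<in>UNIV. slin (T (axis i 1)) ^ Poly_Mapping.lookup m i)"
  by (subst sym_map_superset[of "{m}"]) auto

lemma sym_map_sum: "sym_map T (\<Sum>x\<in>A. g x) = (\<Sum>x\<in>A. sym_map T (g x))"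
proof -
  have "sym_map T 0 = 0" by (simp add: sym_map_def)
  then show ?thesis by (induction A rule: infinite_finite_induct) (auto simp: sym_map_add)
qed

lemma sconst_mult: "sconst (a * b) = sconst a * sconst b"
  by (simp add: sconst_def mult_single)

lemma sym_map_mult:
  fixes p q :: "'n::{finite,linorder} sym"
  shows "sym_map T (p * q) = sym_map T p * sym_map T q"
proof -
  have decomp: "r = (\<Sum>m\<in>Poly_Mapping.keys r. Poly_Mapping.single m (Poly_Mapping.lookup r m))"
    for r :: "'n sym"
    by (intro poly_mapping_eqI) (auto simp: lookup_sum lookup_single when_def in_keys_iff)
  have single: "sym_map T (Poly_Mapping.single m a * Poly_Mapping.single k b) =
      sym_map T (Poly_Mapping.single m a) * sym_map T (Poly_Mapping.single k b)" for m k a b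
    by (simp add: mult_single sym_map_single sconst_mult lookup_add power_add prod.distrib
        algebra_simps)
  let ?P = "\<lambda>r m. Poly_Mapping.single m (Poly_Mapping.lookup r m) :: 'n sym"
  have "sym_map T ((\<Sum>m\<in>Poly_Mapping.keys p. ?P p m) * (\<Sum>k\<in>Poly_Mapping.keys q. ?P q k)) =
      sym_map T (\<Sum>m\<in>Poly_Mapping.keys p. ?P p m) * sym_map T (\<Sum>k\<in>Poly_Mapping.keys q. ?P q k)"
    unfolding sum_product sym_map_sum single ..
  then show ?thesis
    unfolding decomp[symmetric] .
qed

lemma sym_map_sconst [simp]: "sym_map T (sconst a) = sconst a"
  by (simp add: sconst_def[of a] sym_map_single)

lemma slin_add: "slin (v + w) = slin v + slin w"
  by (simp add: slin_def single_add sum.distrib)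

lemma slin_scaleR: "slin (a *\<^sub>R v) = sconst a * slin v"
  by (simp add: slin_def sconst_def sum_distrib_left mult_single)

lemma slin_sum: "slin (\<Sum>x\<in>A. g x) = (\<Sum>x\<in>A. slin (g x))"
proof -
  have "slin 0 = 0" by (simp add: slin_def)
  then show ?thesis by (induction A rule: infinite_finite_induct) (auto simp: slin_add)
qed

lemma sym_map_slin:
  assumes "linear T"
  shows "sym_map T (slin v) = slin (T v)"
proof -
  have v: "v = (\<Sum>i\<in>UNIV. (v $ i) *\<^sub>R axis i 1)"
    by (simp add: vec_eq_iff axis_def if_distrib cong: if_cong)
  have "T v = (\<Sum>i\<in>UNIV. (v $ i) *\<^sub>R T (axis i 1))"
    by (subst v) (simp add: linear_sum[OF assms] linear_cmul[OF assms])
  moreover have "sym_map T (Poly_Mapping.single (Poly_Mapping.single i 1) a) =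
      sconst a * slin (T (axis i 1))" for i a
  proof -
    have "(\<Prod>j\<in>UNIV. slin (T (axis j 1)) ^ Poly_Mapping.lookup (Poly_Mapping.single i 1) j) =
        (\<Prod>j\<in>UNIV. if j = i then slin (T (axis j 1)) else 1)"
      by (intro prod.cong) (auto simp: lookup_single when_def)
    then show ?thesis by (simp add: sym_map_single)
  qed
  ultimately show ?thesis
    by (simp add: slin_def[of v] sym_map_sum slin_sum slin_scaleR)
qed

section \<open>Abstract one-skeleta\<close>

text \<open>
  A finite graph with oriented edges is a finite bidirected digraph: \<open>arcs G\<close> are the oriented
  edges, \<open>arev\<close> reverses them, and \<open>out_arcs G p\<close> is \<open>E\<^sub>p\<close>.
\<close>

locale one_skeleton = fin_digraph G + bidirected_digraph G arev
  for G :: "('a, 'b) pre_digraph" and arev :: "'b \<Rightarrow> 'b" +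
  fixes d :: nat and \<alpha> :: "'b \<Rightarrow> 'n::{finite,linorder} weight"
  assumes valent: "\<And>p. p \<in> verts G \<Longrightarrow> card (out_arcs G p) = d"
    and pairwise_independent:
      "\<And>p e e'. \<lbrakk>p \<in> verts G; e \<in> out_arcs G p; e' \<in> out_arcs G p; e \<noteq> e'\<rbrakk>
        \<Longrightarrow> \<alpha> e \<noteq> \<alpha> e' \<and> independent {\<alpha> e, \<alpha> e'}"
    and alpha_rev: "\<And>e. e \<in> arcs G \<Longrightarrow> \<alpha> (arev e) = - \<alpha> e"
    and connection: "\<And>e. e \<in> arcs G \<Longrightarrow>
        \<exists>(es :: nat \<Rightarrow> 'b) (es' :: nat \<Rightarrow> 'b) (k :: nat \<Rightarrow> real).
          bij_betw es {1..d} (out_arcs G (tail G e)) \<and>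
          bij_betw es' {1..d} (out_arcs G (head G e)) \<and>
          es d = e \<and> es' d = arev e \<and>
          (\<forall>i\<in>{1..d}. \<alpha> (es' i) = \<alpha> (es i) + k i *\<^sub>R \<alpha> e)"

definition polarizing ::
  "('a, 'b) pre_digraph \<Rightarrow> ('b \<Rightarrow> 'n::{finite,linorder} weight) \<Rightarrow> ('n weight \<Rightarrow> real) \<Rightarrow> bool" where
  "polarizing G \<alpha> \<xi> \<longleftrightarrow> (\<forall>e\<in>arcs G. \<xi> (\<alpha> e) \<noteq> 0)"

definition generic ::
  "('a, 'b) pre_digraph \<Rightarrow> ('b \<Rightarrow> 'n::{finite,linorder} weight) \<Rightarrow> ('n weight \<Rightarrow> real) \<Rightarrow> bool" where
  "generic G \<alpha> \<xi> \<longleftrightarrow>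
    (let u = (\<lambda>e. (1 / \<xi> (\<alpha> e)) *\<^sub>R \<alpha> e) in
     \<forall>p\<in>verts G. \<forall>e1\<in>out_arcs G p. \<forall>e2\<in>out_arcs G p. \<forall>e3\<in>out_arcs G p. \<forall>e4\<in>out_arcs G p.
       e1 \<noteq> e2 \<longrightarrow> e3 \<noteq> e4 \<longrightarrow> (e1, e2) \<noteq> (e3, e4) \<longrightarrow> u e1 - u e2 \<noteq> u e3 - u e4)"

definition xi_acyclic ::
  "('a, 'b) pre_digraph \<Rightarrow> ('b \<Rightarrow> 'n::{finite,linorder} weight) \<Rightarrow> ('n weight \<Rightarrow> real) \<Rightarrow> bool" where
  "xi_acyclic G \<alpha> \<xi> \<longleftrightarrow> (\<nexists>w. pre_digraph.cycle (G\<lparr>arcs := {e \<in> arcs G. \<xi> (\<alpha> e) > 0}\<rparr>) w)"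

definition xi_compatible ::
  "('a, 'b) pre_digraph \<Rightarrow> ('b \<Rightarrow> 'n::{finite,linorder} weight) \<Rightarrow> ('n weight \<Rightarrow> real) \<Rightarrow> ('a \<Rightarrow> real) \<Rightarrow> bool" where
  "xi_compatible G \<alpha> \<xi> \<phi> \<longleftrightarrow> (\<forall>e\<in>arcs G. \<xi> (\<alpha> e) > 0 \<longrightarrow> \<phi> (tail G e) < \<phi> (head G e))"

section \<open>The cohomology ring, cross-sections and integration\<close>

text \<open>
  Maps defined on a finite set of vertices or edges are extensional functions. The definitions below
  make sense for any graph with weights and are used both for the one-skeleton itself and
  for its subgraphs.
\<close>

definition cohomology ::
  "('a, 'b) pre_digraph \<Rightarrow> ('b \<Rightarrow> 'n::{finite,linorder} weight) \<Rightarrow> ('a \<Rightarrow> 'n sym) set" where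
  "cohomology G \<alpha> = {h \<in> extensional (verts G).
     \<forall>e\<in>arcs G. slin (\<alpha> e) dvd h (tail G e) - h (head G e)}"

definition cross_section :: "('a, 'b) pre_digraph \<Rightarrow> ('a \<Rightarrow> real) \<Rightarrow> real \<Rightarrow> 'b set" where
  "cross_section G \<phi> c = {e \<in> arcs G. \<phi> (tail G e) < c \<and> c < \<phi> (head G e)}"

definition kirwan ::
  "('a, 'b) pre_digraph \<Rightarrow> ('b \<Rightarrow> 'n::{finite,linorder} weight) \<Rightarrow> ('n weight \<Rightarrow> real) \<Rightarrow> ('a \<Rightarrow> real) \<Rightarrow> real
    \<Rightarrow> ('a \<Rightarrow> 'n sym) \<Rightarrow> 'b \<Rightarrow> 'n sym" where
  "kirwan G \<alpha> \<xi> \<phi> c h = (\<lambda>e\<in>cross_section G \<phi> c. rho \<xi> (\<alpha> e) (h (tail G e)))"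

definition cross_integral ::
  "('a, 'b) pre_digraph \<Rightarrow> ('b \<Rightarrow> 'n::{finite,linorder} weight) \<Rightarrow> ('n weight \<Rightarrow> real) \<Rightarrow> ('a \<Rightarrow> real) \<Rightarrow> real
    \<Rightarrow> ('b \<Rightarrow> 'n sym fract) \<Rightarrow> 'n sym fract" where
  "cross_integral G \<alpha> \<xi> \<phi> c f =
    (\<Sum>e\<in>cross_section G \<phi> c.
       f e / (to_quot (sconst (\<xi> (\<alpha> e))) *
         (\<Prod>e'\<in>out_arcs G (tail G e) - {e}. to_quot (rho \<xi> (\<alpha> e) (slin (\<alpha> e'))))))"

definition cross_module ::
  "('a, 'b) pre_digraph \<Rightarrow> ('b \<Rightarrow> 'n::{finite,linorder} weight) \<Rightarrow> ('n weight \<Rightarrow> real) \<Rightarrow> ('a \<Rightarrow> real) \<Rightarrow> real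
    \<Rightarrow> ('b \<Rightarrow> 'n sym fract) set" where
  "cross_module G \<alpha> \<xi> \<phi> c =
    {f \<in> cross_section G \<phi> c \<rightarrow>\<^sub>E quot_of (annihilator \<xi>).
      \<forall>h\<in>cohomology G \<alpha>.
        cross_integral G \<alpha> \<xi> \<phi> c (\<lambda>e. f e * to_quot (kirwan G \<alpha> \<xi> \<phi> c h e))
          \<in> to_quot ` sym_of (annihilator \<xi>)}"

section \<open>The hypergraph\<close>

definition weight_subgraph ::
  "('a, 'b) pre_digraph \<Rightarrow> ('b \<Rightarrow> 'n::{finite,linorder} weight) \<Rightarrow> 'n weight set \<Rightarrow> ('a, 'b) pre_digraph" where
  "weight_subgraph G \<alpha> W = G\<lparr>arcs := {e \<in> arcs G. \<alpha> e \<in> W}\<rparr>"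

text \<open>The arcs of a weight subgraph of a one-skeleton are closed under reversal, so directed
  reachability is undirected connectedness.\<close>

definition component_of :: "('a, 'b) pre_digraph \<Rightarrow> 'a \<Rightarrow> ('a, 'b) pre_digraph" where
  "component_of G p = G \<restriction> {q. p \<rightarrow>\<^sup>*\<^bsub>G\<^esub> q}"

text \<open>
  \<open>E\<close> is the hyperedge cut out by the component \<open>G0\<close>. The component is kept as part of the data
  because the module attached to a hyperedge is built from it, and different components
  (for different planes) may cut out the same set of edges.
\<close>

definition hyperedge ::
  "('a, 'b) pre_digraph \<Rightarrow> ('b \<Rightarrow> 'n::{finite,linorder} weight) \<Rightarrow> ('a \<Rightarrow> real) \<Rightarrow> real
    \<Rightarrow> ('a, 'b) pre_digraph \<Rightarrow> 'b set \<Rightarrow> bool" where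
  "hyperedge G \<alpha> \<phi> c G0 E \<longleftrightarrow>
    (\<exists>p\<in>verts G. \<exists>e1\<in>out_arcs G p. \<exists>e2\<in>out_arcs G p.
       dim (span {\<alpha> e1, \<alpha> e2}) = 2 \<and>
       G0 = component_of (weight_subgraph G \<alpha> (span {\<alpha> e1, \<alpha> e2})) p) \<and>
    E = cross_section G0 \<phi> c \<and> E \<noteq> {}"

end

(*
  A class g on a component of the subgraph of a plane becomes, multiplied by the product of the
  weights normal to the component and extended by zero, a class on the whole one-skeleton.
  Those normal weights cancel in the integral, which gives the "only if" part.

  Conversely, the integral over the cross-section is a fraction whose denominator is a product of
  linear forms \<beta>, so it is enough to exclude a pole along each \<beta>. The edges e of the
  cross-section fall into hyperedges, those of the components of the planes spanned by \<alpha> e and \<beta>.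
  On one hyperedge the normal weights x e are prime to \<beta>, and their product divided by x e is the
  Kirwan image of a polynomial in the normal class; hence the partial integral, multiplied by
  that product, is an integral over the hyperedge, so a polynomial.
*)
theory Submission
  imports Defs
begin

section \<open>Divisibility by linear forms\<close>

lemma sconst_0 [simp]: "sconst 0 = 0"
  by (simp add: sconst_def)

lemma sconst_1 [simp]: "sconst 1 = 1"
  by (simp add: sconst_def)

lemma slin_0 [simp]: "slin 0 = 0"
  by (simp add: slin_def)

lemma slin_diff: "slin (v - w) = slin v - slin w"
  using slin_add[of "v - w" w] by simp

lemma slin_axis:
  "slin (axis i 1 :: 'n::{finite,linorder} weight) = Poly_Mapping.single (Poly_Mapping.single i 1) 1"
proof -
  have "slin (axis i 1) = (\<Sum>j\<in>UNIV. if j = i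
      then Poly_Mapping.single (Poly_Mapping.single j 1) (1::real) else 0)"
    unfolding slin_def by (intro sum.cong) (auto simp: axis_def)
  then show ?thesis by simp
qed

lemma sym_of_0 [simp]: "0 \<in> sym_of W"
  using sym_of.const[of 0] by simp

lemma sym_of_1 [simp]: "1 \<in> sym_of W"
  using sym_of.const[of 1] by simp

lemma sym_of_sum: "(\<And>x. x \<in> A \<Longrightarrow> g x \<in> sym_of W) \<Longrightarrow> sum g A \<in> sym_of W"
  by (induction A rule: infinite_finite_induct) (auto intro: sym_of.add)

lemma sym_of_prod: "(\<And>x. x \<in> A \<Longrightarrow> g x \<in> sym_of W) \<Longrightarrow> prod g A \<in> sym_of W"
  by (induction A rule: infinite_finite_induct) (auto intro: sym_of.mult)

lemma single_in_sym_of_UNIV: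
  "Poly_Mapping.single m a \<in> sym_of (UNIV :: 'n::{finite,linorder} weight set)"
proof -
  have pow: "Poly_Mapping.single (Poly_Mapping.single i k) 1 \<in> sym_of (UNIV :: 'n weight set)" for i k
  proof (induction k)
    case (Suc k)
    have "Poly_Mapping.single (Poly_Mapping.single i (Suc k)) (1::real) =
        slin (axis i 1) * Poly_Mapping.single (Poly_Mapping.single i k) 1"
      by (simp add: slin_axis mult_single single_add[symmetric])
    then show ?case
      by (simp add: Suc sym_of.gen sym_of.mult)
  qed simp
  have prod: "(\<Prod>i\<in>A. Poly_Mapping.single (Poly_Mapping.single i (Poly_Mapping.lookup m i)) 1) =
      Poly_Mapping.single (\<Sum>i\<in>A. Poly_Mapping.single i (Poly_Mapping.lookup m i)) (1::real)"
    for A :: "'n set"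
    by (induction A rule: infinite_finite_induct) (auto simp: mult_single)
  have "(\<Sum>i\<in>UNIV. Poly_Mapping.single i (Poly_Mapping.lookup m i)) = m"
    by (intro poly_mapping_eqI) (simp add: lookup_sum lookup_single when_def)
  then have "Poly_Mapping.single m a = sconst a *
      (\<Prod>i\<in>UNIV. Poly_Mapping.single (Poly_Mapping.single i (Poly_Mapping.lookup m i)) 1)"
    by (simp add: prod sconst_def mult_single)
  then show ?thesis
    by (auto intro!: sym_of.mult sym_of_prod sym_of.const pow)
qed

text \<open>Every monomial is a product of variables, and these are linear forms. Rule induction on
  \<open>sym_of UNIV\<close> thereby becomes an induction over all polynomials: constants, linear
  forms, sums and products.\<close>

lemma sym_of_UNIV [simp]: "p \<in> sym_of UNIV"
proof -
  have "p = (\<Sum>m\<in>Poly_Mapping.keys p. Poly_Mapping.single m (Poly_Mapping.lookup p m))"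
    by (intro poly_mapping_eqI) (auto simp: lookup_sum lookup_single when_def in_keys_iff)
  then show ?thesis
    by (metis sym_of_sum single_in_sym_of_UNIV)
qed

lemma sym_map_0 [simp]: "sym_map T 0 = 0"
  by (simp add: sym_map_def)

lemma sym_map_1 [simp]: "sym_map T 1 = 1"
  using sym_map_sconst[of T 1] by simp

lemma sym_map_diff: "sym_map T (p - q) = sym_map T p - sym_map T q"
  using sym_map_add[of T "p - q" q] by simp

lemma sym_map_prod: "sym_map T (prod g A) = (\<Prod>x\<in>A. sym_map T (g x))"
  by (induction A rule: infinite_finite_induct) (auto simp: sym_map_mult)

lemma sym_map_in_sym_of:
  assumes "linear T" "range T \<subseteq> W"
  shows "sym_map T p \<in> sym_of W"
  using sym_of_UNIV[of p]
proof induction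
  case (gen v)
  then show ?case using assms by (auto simp: sym_map_slin intro!: sym_of.gen)
qed (auto simp: sym_map_add sym_map_mult intro: sym_of.intros)

lemma sym_map_fixes:
  assumes "linear T" "\<And>v. v \<in> W \<Longrightarrow> T v = v" "p \<in> sym_of W"
  shows "sym_map T p = p"
  using assms(3)
  by induction (auto simp: sym_map_add sym_map_mult sym_map_slin assms)

lemma dvd_mult_diff_mult:
  fixes x :: "'a::comm_ring_1"
  assumes "x dvd a - b" "x dvd a' - b'"
  shows "x dvd a * a' - b * b'"
proof -
  have "a * a' - b * b' = (a - b) * a' + b * (a' - b')" by (simp add: algebra_simps)
  then show ?thesis using assms by (metis dvd_add dvd_mult dvd_mult2)
qed

lemma dvd_prod_diff_prod:
  fixes x :: "'a::comm_ring_1"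
  assumes "\<And>i. i \<in> A \<Longrightarrow> x dvd f i - g i"
  shows "x dvd prod f A - prod g A"
  using assms by (induction A rule: infinite_finite_induct) (auto intro: dvd_mult_diff_mult)

section \<open>Projections along a linear form, and primality of linear forms\<close>

lemma linear_project:
  assumes "linear \<xi>"
  shows "linear (\<lambda>\<gamma>. \<gamma> - (\<xi> \<gamma> / \<xi> a) *\<^sub>R a)"
  using assms by (intro linearI) (auto simp: linear_add linear_cmul algebra_simps add_divide_distrib)

lemma rho_slin: "linear \<xi> \<Longrightarrow> rho \<xi> a (slin v) = slin (v - (\<xi> v / \<xi> a) *\<^sub>R a)"
  by (simp add: rho_def sym_map_slin linear_project)

lemma rho_self:
  assumes "linear \<xi>" "\<xi> a \<noteq> 0"
  shows "rho \<xi> a (slin a) = 0"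
  using assms by (simp add: rho_slin)

lemma rho_0 [simp]: "rho \<xi> a 0 = 0"
  by (simp add: rho_def)

lemma rho_mult: "rho \<xi> a (p * q) = rho \<xi> a p * rho \<xi> a q"
  by (simp add: rho_def sym_map_mult)

lemma rho_diff: "rho \<xi> a (p - q) = rho \<xi> a p - rho \<xi> a q"
  by (simp add: rho_def sym_map_diff)

lemma rho_prod: "rho \<xi> a (prod g A) = (\<Prod>x\<in>A. rho \<xi> a (g x))"
  by (simp add: rho_def sym_map_prod)

lemma rho_in_sym_of:
  assumes "linear \<xi>" "\<xi> a \<noteq> 0"
  shows "rho \<xi> a p \<in> sym_of (annihilator \<xi>)"
  unfolding rho_def using assms
  by (intro sym_map_in_sym_of linear_project)
    (auto simp: annihilator_def linear_diff linear_cmul)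

lemma rho_fixes:
  assumes "linear \<xi>" "p \<in> sym_of (annihilator \<xi>)"
  shows "rho \<xi> a p = p"
  unfolding rho_def using assms
  by (intro sym_map_fixes[of _ "annihilator \<xi>"] linear_project) (auto simp: annihilator_def)

text \<open>On a linear form \<open>rho\<close> subtracts a multiple of \<open>a\<close>; congruence
  modulo \<open>slin a\<close> is then inherited by sums and products.\<close>

lemma slin_dvd_diff_rho:
  assumes "linear \<xi>"
  shows "slin a dvd p - rho \<xi> a p"
  using sym_of_UNIV[of p]
proof induction
  case (gen v)
  have "slin v - rho \<xi> a (slin v) = sconst (\<xi> v / \<xi> a) * slin a"
    by (simp add: rho_slin[OF assms] slin_diff slin_scaleR)
  then show ?case by simp
next
  case (add p q)
  then have "slin a dvd (p - rho \<xi> a p) + (q - rho \<xi> a q)" by (intro dvd_add)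
  then show ?case by (simp add: rho_def sym_map_add algebra_simps)
next
  case (mult p q)
  then show ?case by (simp add: rho_mult dvd_mult_diff_mult)
qed (simp add: rho_def)

text \<open>The kernel of \<open>rho\<close> is the ideal of \<open>slin a\<close>:
  \<open>rho\<close> kills the generator and alters \<open>p\<close> only by a multiple of
  it.\<close>

lemma slin_dvd_iff_rho:
  assumes "linear \<xi>" "\<xi> a \<noteq> 0"
  shows "slin a dvd p \<longleftrightarrow> rho \<xi> a p = 0"
  using slin_dvd_diff_rho[OF assms(1), of a p] rho_self[OF assms]
  by (auto simp: rho_mult elim!: dvdE)

text \<open>Linear forms are prime: projecting along \<open>v\<close> is a morphism to a domain whose kernel is
  generated by \<open>slin v\<close>.\<close>

lemma slin_dvd_prod_iff:
  assumes "finite A" "v \<noteq> 0"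
  shows "slin v dvd prod g A \<longleftrightarrow> (\<exists>x\<in>A. slin v dvd g x)"
proof -
  \<comment> \<open>The functional is the inner product with \<open>v\<close>, which cannot vanish
    at a nonzero \<open>v\<close>. Thus the result also serves for the denominators of the integral,
    on which the polarizing functional is zero.\<close>
  have "linear (\<lambda>w. v \<bullet> w)" "v \<bullet> v \<noteq> 0"
    using assms by (auto intro: bounded_linear.linear bounded_linear_inner_right)
  from slin_dvd_iff_rho[OF this] show ?thesis
    using assms by (simp add: rho_prod)
qed

lemma slin_dvd_mult_iff:
  assumes "v \<noteq> 0"
  shows "slin v dvd p * q \<longleftrightarrow> slin v dvd p \<or> slin v dvd q"
  using slin_dvd_prod_iff[of UNIV v "\<lambda>b. if b then q else p"] assms
  by (simp add: UNIV_bool ex_bool_eq)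

lemma slin_eq_0_iff [simp]: "slin v = 0 \<longleftrightarrow> v = 0"
proof
  assume *: "slin v = 0"
  have "v $ i = Poly_Mapping.lookup (slin v) (Poly_Mapping.single i 1)" for i
  proof -
    have "Poly_Mapping.lookup (slin v) (Poly_Mapping.single i 1) = (\<Sum>j\<in>UNIV. if j = i then v $ j else 0)"
      unfolding slin_def lookup_sum
      by (intro sum.cong) (auto simp: lookup_single when_def dest: arg_cong[of "Poly_Mapping.single _ _" _ Poly_Mapping.keys])
    then show ?thesis by simp
  qed
  with * show "v = 0" by (simp add: vec_eq_iff)
qed simp

lemma slin_dvd_slin:
  assumes "v \<noteq> 0" "slin v dvd slin w"
  shows "w \<in> span {v}"
proof -
  have l: "linear (\<lambda>w. v \<bullet> w)" "v \<bullet> v \<noteq> 0"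
    using assms by (auto intro: bounded_linear.linear bounded_linear_inner_right)
  have "w - (v \<bullet> w / (v \<bullet> v)) *\<^sub>R v = 0"
    using assms(2) slin_dvd_iff_rho[OF l] by (simp add: rho_slin[OF l(1)])
  then show ?thesis by (metis eq_iff_diff_eq_0 span_base span_scale singletonI)
qed

section \<open>Embedding in the quotient field, and fractions without poles\<close>

lemma to_quot_0 [simp]: "to_quot 0 = 0"
  by (simp add: to_quot_def Zero_fract_def)

lemma to_quot_1 [simp]: "to_quot 1 = 1"
  by (simp add: to_quot_def One_fract_def)

lemma to_quot_add: "to_quot (p + q) = to_quot p + to_quot q"
  by (simp add: to_quot_def)

lemma to_quot_mult: "to_quot (p * q) = to_quot p * to_quot q"
  by (simp add: to_quot_def)

lemma to_quot_eq_iff [simp]: "to_quot p = to_quot q \<longleftrightarrow> p = q"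
  by (simp add: to_quot_def eq_fract)

lemma to_quot_eq_0_iff [simp]: "to_quot p = 0 \<longleftrightarrow> p = 0"
  using to_quot_eq_iff[of p 0] by (simp del: to_quot_eq_iff)

lemma to_quot_prod: "to_quot (prod g A) = (\<Prod>x\<in>A. to_quot (g x))"
  by (induction A rule: infinite_finite_induct) (auto simp: to_quot_mult)

lemma to_quot_sum: "to_quot (sum g A) = (\<Sum>x\<in>A. to_quot (g x))"
  by (induction A rule: infinite_finite_induct) (auto simp: to_quot_add)

lemma inverse_to_quot_sconst: "a \<noteq> 0 \<Longrightarrow> inverse (to_quot (sconst a)) = to_quot (sconst (1 / a))"
  by (intro inverse_unique) (simp flip: to_quot_mult sconst_mult)

text \<open>A multiplier \<open>T\<close> prime to \<open>b i\<close> witnesses that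
  \<open>A\<close> has no pole along \<open>b i\<close>. By primality of linear forms the factors
  can then be cancelled from the denominator one at a time, so repetitions in the family
  \<open>b\<close> do no harm.\<close>

lemma no_poles:
  assumes "finite I" "\<And>i. i \<in> I \<Longrightarrow> b i \<noteq> 0"
    and "A * to_quot (\<Prod>i\<in>I. slin (b i)) \<in> range to_quot"
    and "\<And>i. i \<in> I \<Longrightarrow> \<exists>T. \<not> slin (b i) dvd T \<and> A * to_quot T \<in> range to_quot"
  shows "A \<in> range to_quot"
  using assms
proof (induction I rule: finite_induct)
  case (insert i I)
  let ?D = "\<Prod>i\<in>I. slin (b i)"
  obtain T where T: "\<not> slin (b i) dvd T" "A * to_quot T \<in> range to_quot"
    using insert.prems(3) by blast
  from T(2) obtain S where S: "A * to_quot T = to_quot S" by auto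
  from insert obtain N where N: "A * to_quot (slin (b i) * ?D) = to_quot N" by auto
  have "to_quot (T * N) = to_quot (S * (slin (b i) * ?D))"
    unfolding to_quot_mult[of T] to_quot_mult[of S] S[symmetric] N[symmetric]
    by (simp add: mult_ac)
  then have "T * N = slin (b i) * (S * ?D)" by (simp add: mult_ac)
  then have "slin (b i) dvd T * N" by simp
  then have "slin (b i) dvd N"
    using T(1) insert.prems(1) by (simp add: slin_dvd_mult_iff)
  then obtain N' where "N = slin (b i) * N'" by (elim dvdE)
  with N insert.prems(1)[of i] have "A * to_quot ?D = to_quot N'"
    by (simp add: to_quot_mult mult.left_commute)
  then show ?case using insert by auto
qed simp

text \<open>\<open>g t = (prod x A - (\<Prod>i\<in>A. x i - t)) / t\<close> is a polynomial in \<open>t\<close>, which at \<open>t = x j\<close> is the product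
  of the other factors; of its being a polynomial only the divisibility matters.\<close>

lemma complementary_product:
  fixes x :: "'i \<Rightarrow> 'a::comm_ring_1"
  assumes "finite A"
  shows "\<exists>g. (\<forall>s t. s - t dvd g s - g t) \<and> (\<forall>t. t * g t = prod x A - (\<Prod>i\<in>A. x i - t))"
  using assms
proof (induction A rule: finite_induct)
  case empty
  then show ?case by (auto intro!: exI[of _ "\<lambda>_. 0"])
next
  case (insert j A)
  then obtain g where g: "\<And>s t. s - t dvd g s - g t" "\<And>t. t * g t = prod x A - (\<Prod>i\<in>A. x i - t)"
    by blast
  \<comment> \<open>With \<open>P\<close> and \<open>Q\<close> the two products over
    \<open>A\<close>, this comes from \<open>x j * P - (x j - t) * Q = x j * (P - Q) + t * Q\<close>
    on taking out the factor \<open>t\<close>.\<close>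
  let ?g = "\<lambda>t. x j * g t + (\<Prod>i\<in>A. x i - t)"
  have 1: "s - t dvd ?g s - ?g t" for s t
  proof -
    have "s - t dvd t - s"
      using dvd_minus_iff[of "s - t" "s - t"] by simp
    then have "s - t dvd (\<Prod>i\<in>A. x i - s) - (\<Prod>i\<in>A. x i - t)"
      by (intro dvd_prod_diff_prod) simp
    moreover have "s - t dvd x j * (g s - g t)" using g(1) by simp
    ultimately have "s - t dvd x j * (g s - g t) + ((\<Prod>i\<in>A. x i - s) - (\<Prod>i\<in>A. x i - t))"
      by (rule dvd_add[rotated])
    then show ?thesis by (simp add: algebra_simps)
  qed
  have 2: "t * ?g t = prod x (insert j A) - (\<Prod>i\<in>insert j A. x i - t)" for t
  proof -
    have "t * ?g t = x j * (t * g t) + t * (\<Prod>i\<in>A. x i - t)" by (simp add: algebra_simps)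
    then show ?thesis using insert.hyps by (simp add: g(2) algebra_simps)
  qed
  show ?case
    by (intro exI[of _ ?g] conjI allI) (rule 1, rule 2)
qed

lemma to_quot_in_quot_of: "p \<in> sym_of W \<Longrightarrow> to_quot p \<in> quot_of W"
  unfolding quot_of_def by (intro CollectI exI[of _ p] exI[of _ 1]) simp

section \<open>Components of weight subgraphs\<close>

lemma cohomologyD: "h \<in> cohomology G \<alpha> \<Longrightarrow> e \<in> arcs G \<Longrightarrow> slin (\<alpha> e) dvd h (tail G e) - h (head G e)"
  by (simp add: cohomology_def)

locale polarized_one_skeleton = one_skeleton G arev d \<alpha>
  for G :: "('a, 'b) pre_digraph" and arev d and \<alpha> :: "'b \<Rightarrow> 'n::{finite,linorder} weight" +
  fixes \<xi> :: "'n weight \<Rightarrow> real"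
  assumes linear_xi: "linear \<xi>" and polarizing_xi: "polarizing G \<alpha> \<xi>"
begin

abbreviation leaf :: "'n weight set \<Rightarrow> 'a \<Rightarrow> ('a, 'b) pre_digraph" where
  "leaf W p \<equiv> component_of (weight_subgraph G \<alpha> W) p"

lemma xi_neq_0: "e \<in> arcs G \<Longrightarrow> \<xi> (\<alpha> e) \<noteq> 0"
  using polarizing_xi by (simp add: polarizing_def)

lemma tail_leaf [simp]: "tail (leaf W p) = tail G"
  and head_leaf [simp]: "head (leaf W p) = head G"
  by (simp_all add: component_of_def weight_subgraph_def)

lemma wf_weight_subgraph: "wf_digraph (weight_subgraph G \<alpha> W)"
  by unfold_locales (auto simp: weight_subgraph_def)

lemma self_in_leaf: "p \<in> verts G \<Longrightarrow> p \<in> verts (leaf W p)"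
  using wf_digraph.reachable_refl[OF wf_weight_subgraph, of p W]
  by (simp add: component_of_def weight_subgraph_def)

lemma symmetric_weight_subgraph:
  assumes "subspace W"
  shows "symmetric (weight_subgraph G \<alpha> W)"
  unfolding symmetric_def
proof (rule symI)
  fix u v assume "u \<rightarrow>\<^bsub>weight_subgraph G \<alpha> W\<^esub> v"
  then obtain e where e: "e \<in> arcs G" "\<alpha> e \<in> W" "tail G e = u" "head G e = v"
    by (elim reachableE) (auto simp: weight_subgraph_def)
  then have "arev e \<in> arcs (weight_subgraph G \<alpha> W)"
    using assms by (simp add: weight_subgraph_def alpha_rev subspace_neg)
  with e show "v \<rightarrow>\<^bsub>weight_subgraph G \<alpha> W\<^esub> u"
    by (intro wf_digraph.dominatesI[OF wf_weight_subgraph, where a = "arev e"])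
      (simp_all add: arc_to_ends_def weight_subgraph_def)
qed

text \<open>Reachability is symmetric here, hence an equivalence relation, and any vertex of the
  component may serve as its base point.\<close>

lemma leaf_eq:
  assumes "subspace W" "q \<in> verts (leaf W p)"
  shows "leaf W q = leaf W p"
proof -
  interpret W: wf_digraph "weight_subgraph G \<alpha> W" by (rule wf_weight_subgraph)
  have pq: "p \<rightarrow>\<^sup>*\<^bsub>weight_subgraph G \<alpha> W\<^esub> q"
    using assms by (simp add: component_of_def)
  then have qp: "q \<rightarrow>\<^sup>*\<^bsub>weight_subgraph G \<alpha> W\<^esub> p"
    by (rule symmetric_reachable[OF symmetric_weight_subgraph[OF assms(1)]])
  have "p \<rightarrow>\<^sup>*\<^bsub>weight_subgraph G \<alpha> W\<^esub> r \<longleftrightarrow> q \<rightarrow>\<^sup>*\<^bsub>weight_subgraph G \<alpha> W\<^esub> r" for r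
    using W.reachable_trans[OF pq] W.reachable_trans[OF qp] by blast
  then show ?thesis by (simp add: component_of_def)
qed

lemma head_in_leaf:
  assumes "e \<in> arcs G" "\<alpha> e \<in> W" "tail G e \<in> verts (leaf W p)"
  shows "head G e \<in> verts (leaf W p)"
proof -
  interpret W: wf_digraph "weight_subgraph G \<alpha> W" by (rule wf_weight_subgraph)
  have "tail G e \<rightarrow>\<^bsub>weight_subgraph G \<alpha> W\<^esub> head G e"
    using assms by (intro W.dominatesI[of e]) (simp_all add: arc_to_ends_def weight_subgraph_def)
  with assms(3) show ?thesis
    by (auto simp: component_of_def intro: W.reachable_adj_trans)
qed

lemma arcs_leaf: "arcs (leaf W p) = {e \<in> arcs G. \<alpha> e \<in> W \<and> tail G e \<in> verts (leaf W p)}"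
  using head_in_leaf[of _ W p]
  by (auto simp: component_of_def weight_subgraph_def)

lemma tail_in_leaf:
  assumes "subspace W" "e \<in> arcs G" "\<alpha> e \<in> W" "head G e \<in> verts (leaf W p)"
  shows "tail G e \<in> verts (leaf W p)"
  using head_in_leaf[of "arev e" W p] assms by (simp add: alpha_rev subspace_neg)

lemma cross_section_leaf:
  "cross_section (leaf W p) \<phi> c =
    {e \<in> cross_section G \<phi> c. \<alpha> e \<in> W \<and> tail G e \<in> verts (leaf W p)}"
  by (auto simp: cross_section_def arcs_leaf)

lemma finite_cross_section: "finite (cross_section G \<phi> c)"
  by (simp add: cross_section_def)

section \<open>Euler classes of the directions normal and tangent to a component\<close>

definition normal_class :: "'n weight set \<Rightarrow> 'a \<Rightarrow> 'n sym" where
  "normal_class W q = (\<Prod>e\<in>{e \<in> out_arcs G q. \<alpha> e \<notin> W}. slin (\<alpha> e))"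

text \<open>The connection along \<open>e\<close> matches the edges at both ends so that weights
  differ by multiples of \<open>\<alpha> e\<close>. As \<open>\<alpha> e\<close> lies in
  \<open>W\<close>, normal edges are matched with normal ones, and the two products are congruent
  factor by factor.\<close>

lemma normal_class_congruent:
  assumes W: "subspace W" and e: "e \<in> arcs G" "\<alpha> e \<in> W"
  shows "slin (\<alpha> e) dvd normal_class W (tail G e) - normal_class W (head G e)"
proof -
  obtain es es' :: "nat \<Rightarrow> 'b" and k :: "nat \<Rightarrow> real" where
    "bij_betw es {1..d} (out_arcs G (tail G e)) \<and> bij_betw es' {1..d} (out_arcs G (head G e)) \<and>
      es d = e \<and> es' d = arev e \<and> (\<forall>i\<in>{1..d}. \<alpha> (es' i) = \<alpha> (es i) + k i *\<^sub>R \<alpha> e)"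
    using connection[OF e(1)] by (elim exE) (rule that, assumption)
  then have bij: "bij_betw es {1..d} (out_arcs G (tail G e))"
      "bij_betw es' {1..d} (out_arcs G (head G e))"
    and k: "\<And>i. i \<in> {1..d} \<Longrightarrow> \<alpha> (es' i) = \<alpha> (es i) + k i *\<^sub>R \<alpha> e"
    by simp_all
  let ?I = "{i \<in> {1..d}. \<alpha> (es i) \<notin> W}"
  have iff: "\<alpha> (es' i) \<in> W \<longleftrightarrow> \<alpha> (es i) \<in> W" if "i \<in> {1..d}" for i
  proof -
    have "k i *\<^sub>R \<alpha> e \<in> W" using W e by (simp add: subspace_scale)
    then show ?thesis
      using W subspace_add[OF W, of "\<alpha> (es i)" "k i *\<^sub>R \<alpha> e"]
        subspace_diff[OF W, of "\<alpha> (es' i)" "k i *\<^sub>R \<alpha> e"]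
      by (auto simp: k[OF that])
  qed
  have "bij_betw es ?I {e' \<in> out_arcs G (tail G e). \<alpha> e' \<notin> W}"
    by (intro bij_betw_Collect[OF bij(1)]) simp
  then have tail: "normal_class W (tail G e) = (\<Prod>i\<in>?I. slin (\<alpha> (es i)))"
    unfolding normal_class_def by (rule prod.reindex_bij_betw[symmetric])
  have "bij_betw es' ?I {e' \<in> out_arcs G (head G e). \<alpha> e' \<notin> W}"
    by (intro bij_betw_Collect[OF bij(2)]) (simp add: iff)
  then have head: "normal_class W (head G e) = (\<Prod>i\<in>?I. slin (\<alpha> (es' i)))"
    unfolding normal_class_def by (rule prod.reindex_bij_betw[symmetric])
  show ?thesis
    unfolding tail head by (intro dvd_prod_diff_prod) (simp add: k slin_add slin_scaleR)
qed

lemma slin_dvd_normal_class: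
  assumes "e \<in> out_arcs G q" "\<alpha> e \<notin> W"
  shows "slin (\<alpha> e) dvd normal_class W q"
proof -
  have "finite {e \<in> out_arcs G q. \<alpha> e \<notin> W}" by simp
  then have "(\<Prod>e'\<in>{e}. slin (\<alpha> e')) dvd normal_class W q"
    unfolding normal_class_def using assms by (intro prod_dvd_prod_subset) auto
  then show ?thesis by simp
qed

text \<open>Apart from a constant this is the denominator at \<open>e\<close> in the integral over a
  component; \<open>W = UNIV\<close> gives that of the whole graph, so that both integrals take one
  form.\<close>

definition tangent_product :: "'n weight set \<Rightarrow> 'b \<Rightarrow> 'n sym" where
  "tangent_product W e =
    (\<Prod>e'\<in>{e' \<in> out_arcs G (tail G e) - {e}. \<alpha> e' \<in> W}. rho \<xi> (\<alpha> e) (slin (\<alpha> e')))"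

lemma cross_integral_leaf:
  "cross_integral (leaf W p) \<alpha> \<xi> \<phi> c F =
    (\<Sum>e\<in>cross_section (leaf W p) \<phi> c.
      F e / to_quot (sconst (\<xi> (\<alpha> e)) * tangent_product W e))"
  unfolding cross_integral_def
proof (intro sum.cong refl)
  fix e assume "e \<in> cross_section (leaf W p) \<phi> c"
  then have "out_arcs (leaf W p) (tail G e) - {e} = {e' \<in> out_arcs G (tail G e) - {e}. \<alpha> e' \<in> W}"
    by (auto simp: out_arcs_def arcs_leaf cross_section_leaf)
  then show "F e / (to_quot (sconst (\<xi> (\<alpha> e))) *
      (\<Prod>e'\<in>out_arcs (leaf W p) (tail (leaf W p) e) - {e}. to_quot (rho \<xi> (\<alpha> e) (slin (\<alpha> e'))))) =
      F e / to_quot (sconst (\<xi> (\<alpha> e)) * tangent_product W e)"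
    by (simp add: tangent_product_def to_quot_mult to_quot_prod)
qed

lemma tangent_product_UNIV_eq:
  "tangent_product UNIV e = (\<Prod>e'\<in>out_arcs G (tail G e) - {e}. rho \<xi> (\<alpha> e) (slin (\<alpha> e')))"
  unfolding tangent_product_def by (intro prod.cong) auto

lemma cross_integral_UNIV:
  "cross_integral G \<alpha> \<xi> \<phi> c F =
    (\<Sum>e\<in>cross_section G \<phi> c. F e / to_quot (sconst (\<xi> (\<alpha> e)) * tangent_product UNIV e))"
  by (simp add: cross_integral_def tangent_product_UNIV_eq to_quot_mult to_quot_prod)

lemma not_in_span_sibling:
  assumes "e \<in> arcs G" "e' \<in> out_arcs G (tail G e)" "e' \<noteq> e"
  shows "\<alpha> e' \<noteq> \<alpha> e" "independent {\<alpha> e', \<alpha> e}" "\<alpha> e' \<notin> span {\<alpha> e}"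
proof -
  show *: "\<alpha> e' \<noteq> \<alpha> e" "independent {\<alpha> e', \<alpha> e}"
    using pairwise_independent[of "tail G e" e' e] assms by auto
  then show "\<alpha> e' \<notin> span {\<alpha> e}" by (simp add: independent_insert)
qed

text \<open>A zero value would make \<open>\<alpha> e'\<close> a multiple of
  \<open>\<alpha> e\<close>, against pairwise independence. Hence the denominators are
  nonzero.\<close>

lemma rho_sibling_neq_0:
  assumes "e \<in> arcs G" "e' \<in> out_arcs G (tail G e)" "e' \<noteq> e"
  shows "rho \<xi> (\<alpha> e) (slin (\<alpha> e')) \<noteq> 0"
proof
  assume "rho \<xi> (\<alpha> e) (slin (\<alpha> e')) = 0"
  then have "\<alpha> e' = (\<xi> (\<alpha> e') / \<xi> (\<alpha> e)) *\<^sub>R \<alpha> e"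
    by (simp add: rho_slin linear_xi)
  then show False
    using not_in_span_sibling(3)[OF assms] by (metis span_base span_scale singletonI)
qed

lemma tangent_product_neq_0: "e \<in> arcs G \<Longrightarrow> tangent_product W e \<noteq> 0"
  using rho_sibling_neq_0 by (auto simp: tangent_product_def)

text \<open>The other edges at the tail are split by whether their weight is in \<open>W\<close>.
  The projected normal class is the factor that cancels in both directions of the theorem.\<close>

lemma tangent_product_UNIV:
  assumes "e \<in> arcs G" "\<alpha> e \<in> W"
  shows "tangent_product UNIV e =
    tangent_product W e * rho \<xi> (\<alpha> e) (normal_class W (tail G e))"
proof -
  let ?S = "out_arcs G (tail G e) - {e}"
  have split: "?S = {e' \<in> ?S. \<alpha> e' \<in> W} \<union> {e' \<in> out_arcs G (tail G e). \<alpha> e' \<notin> W}"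
    using assms by auto
  have "tangent_product UNIV e = (\<Prod>e'\<in>?S. rho \<xi> (\<alpha> e) (slin (\<alpha> e')))"
    by (rule tangent_product_UNIV_eq)
  also have "\<dots> = tangent_product W e * rho \<xi> (\<alpha> e) (normal_class W (tail G e))"
    unfolding tangent_product_def normal_class_def rho_prod
    by (subst split, rule prod.union_disjoint) auto
  finally show ?thesis .
qed

lemma rho_normal_class_neq_0:
  assumes "e \<in> arcs G" "\<alpha> e \<in> W"
  shows "rho \<xi> (\<alpha> e) (normal_class W (tail G e)) \<noteq> 0"
  using tangent_product_neq_0[OF assms(1), of UNIV] tangent_product_UNIV[OF assms] by auto

text \<open>An edge with weight in \<open>W\<close> has both ends in the component or neither, and
  inside it both factors are congruent along it. For any other edge the normal class at each end has
  the weight as a factor, up to sign, so both values are multiples of it.\<close>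

lemma extend_by_zero:
  assumes W: "subspace W" and g: "g \<in> cohomology (leaf W p) \<alpha>"
  defines "h \<equiv> \<lambda>q\<in>verts G. if q \<in> verts (leaf W p) then g q * normal_class W q else 0"
  shows "h \<in> cohomology G \<alpha>"
  unfolding cohomology_def
proof (intro CollectI conjI ballI)
  show "h \<in> extensional (verts G)" by (simp add: h_def)
next
  fix e assume e: "e \<in> arcs G"
  then have ends: "tail G e \<in> verts G" "head G e \<in> verts G" by simp_all
  show "slin (\<alpha> e) dvd h (tail G e) - h (head G e)"
  proof (cases "\<alpha> e \<in> W")
    case True
    then have iff: "tail G e \<in> verts (leaf W p) \<longleftrightarrow> head G e \<in> verts (leaf W p)"
      using W e head_in_leaf tail_in_leaf by blast
    show ?thesis
    proof (cases "tail G e \<in> verts (leaf W p)")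
      case inside: True
      then have "slin (\<alpha> e) dvd g (tail G e) - g (head G e)"
        using cohomologyD[OF g, of e] e True by (simp add: arcs_leaf)
      then show ?thesis
        using inside iff ends normal_class_congruent[OF W e True]
        by (simp add: h_def dvd_mult_diff_mult)
    qed (use iff ends in \<open>simp add: h_def\<close>)
  next
    case False
    have "slin (\<alpha> e) dvd normal_class W (tail G e)"
      using e False by (intro slin_dvd_normal_class) simp_all
    moreover have "slin (\<alpha> (arev e)) dvd normal_class W (head G e)"
      using e False subspace_neg[OF W, of "- \<alpha> e"]
      by (intro slin_dvd_normal_class) (auto simp: alpha_rev)
    then have "slin (\<alpha> e) dvd normal_class W (head G e)"
      using slin_diff[of 0 "\<alpha> e"] e by (simp add: alpha_rev)
    ultimately show ?thesis
      using ends by (simp add: h_def)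
  qed
qed

section \<open>Integration over hyperedges\<close>

lemma annihilator_rho_edge: "e \<in> arcs G \<Longrightarrow> rho \<xi> (\<alpha> e) p \<in> sym_of (annihilator \<xi>)"
  by (intro rho_in_sym_of linear_xi xi_neq_0)

text \<open>\<open>F\<close> is paired with the extension by zero of \<open>g\<close>. Off the edges
  of the component the projection kills the extension; on them its normal class cancels against the
  denominator.\<close>

lemma cross_module_leaf:
  assumes W: "subspace W" and F: "F \<in> cross_module G \<alpha> \<xi> \<phi> c"
  shows "restrict F (cross_section (leaf W p) \<phi> c) \<in> cross_module (leaf W p) \<alpha> \<xi> \<phi> c"
  unfolding cross_module_def
proof (intro CollectI conjI ballI)
  let ?C = "cross_section (leaf W p) \<phi> c"
  show "restrict F ?C \<in> ?C \<rightarrow>\<^sub>E quot_of (annihilator \<xi>)"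
    using F by (auto simp: cross_module_def cross_section_leaf)
next
  fix g assume g: "g \<in> cohomology (leaf W p) \<alpha>"
  let ?C = "cross_section (leaf W p) \<phi> c"
  let ?V = "cross_section G \<phi> c"
  let ?h = "\<lambda>q\<in>verts G. if q \<in> verts (leaf W p) then g q * normal_class W q else 0"
  let ?m = "\<lambda>e. sconst (\<xi> (\<alpha> e))"
  have V: "e \<in> arcs G" "tail G e \<in> verts G" if "e \<in> ?V" for e
    using that by (auto simp: cross_section_def)
  have "cross_integral G \<alpha> \<xi> \<phi> c (\<lambda>e. F e * to_quot (kirwan G \<alpha> \<xi> \<phi> c ?h e))
      \<in> to_quot ` sym_of (annihilator \<xi>)"
    using F extend_by_zero[OF W g] unfolding cross_module_def by blast
  also have "cross_integral G \<alpha> \<xi> \<phi> c (\<lambda>e. F e * to_quot (kirwan G \<alpha> \<xi> \<phi> c ?h e)) =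
      (\<Sum>e\<in>?V. F e * to_quot (rho \<xi> (\<alpha> e) (?h (tail G e))) / to_quot (?m e * tangent_product UNIV e))"
    unfolding cross_integral_UNIV by (intro sum.cong) (simp_all add: kirwan_def)
  also have "\<dots> = (\<Sum>e\<in>?C. F e * to_quot (rho \<xi> (\<alpha> e) (?h (tail G e))) /
      to_quot (?m e * tangent_product UNIV e))"
  proof (intro sum.mono_neutral_right ballI finite_cross_section)
    fix e assume "e \<in> ?V - ?C"
    then have e: "e \<in> ?V" "\<alpha> e \<in> W \<Longrightarrow> tail G e \<notin> verts (leaf W p)"
      by (auto simp: cross_section_leaf)
    have "rho \<xi> (\<alpha> e) (?h (tail G e)) = 0"
    proof (cases "tail G e \<in> verts (leaf W p)")
      \<comment> \<open>The edge starts in the component but is normal to it: its own weight is a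
        factor of the normal class there, and \<open>rho\<close> kills that weight.\<close>
      case True
      then have "slin (\<alpha> e) dvd normal_class W (tail G e)"
        using e V(1)[OF e(1)] by (intro slin_dvd_normal_class) auto
      then have "rho \<xi> (\<alpha> e) (normal_class W (tail G e)) = 0"
        using slin_dvd_iff_rho[OF linear_xi xi_neq_0] V(1)[OF e(1)] by blast
      with True V(2)[OF e(1)] show ?thesis by (simp add: rho_mult)
    qed (use V(2)[OF e(1)] in simp)
    then show "F e * to_quot (rho \<xi> (\<alpha> e) (?h (tail G e))) / to_quot (?m e * tangent_product UNIV e) = 0"
      by simp
  qed (auto simp: cross_section_leaf)
  also have "\<dots> = (\<Sum>e\<in>?C. F e * to_quot (rho \<xi> (\<alpha> e) (g (tail G e))) / to_quot (?m e * tangent_product W e))"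
  proof (intro sum.cong refl)
    fix e assume "e \<in> ?C"
    then have e: "e \<in> ?V" "\<alpha> e \<in> W" "tail G e \<in> verts (leaf W p)"
      by (auto simp: cross_section_leaf)
    have "to_quot (rho \<xi> (\<alpha> e) (normal_class W (tail G e))) \<noteq> 0"
      using rho_normal_class_neq_0[OF V(1)[OF e(1)] e(2)] by simp
    then show "F e * to_quot (rho \<xi> (\<alpha> e) (?h (tail G e))) / to_quot (?m e * tangent_product UNIV e) =
        F e * to_quot (rho \<xi> (\<alpha> e) (g (tail G e))) / to_quot (?m e * tangent_product W e)"
      using e V(2)[OF e(1)]
      by (simp add: tangent_product_UNIV[OF V(1)[OF e(1)] e(2)] rho_mult to_quot_mult)
  qed
  also have "\<dots> = cross_integral (leaf W p) \<alpha> \<xi> \<phi> c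
      (\<lambda>e. restrict F ?C e * to_quot (kirwan (leaf W p) \<alpha> \<xi> \<phi> c g e))"
    unfolding cross_integral_leaf by (intro sum.cong) (simp_all add: kirwan_def)
  finally show "cross_integral (leaf W p) \<alpha> \<xi> \<phi> c
      (\<lambda>e. restrict F ?C e * to_quot (kirwan (leaf W p) \<alpha> \<xi> \<phi> c g e))
      \<in> to_quot ` sym_of (annihilator \<xi>)" .
qed

section \<open>Converse: from hyperedges to the whole cross-section\<close>

text \<open>\<open>T\<close> is the product of the projected normal classes over the cross-section
  of the component. The assumption \<open>integral\<close> speaks of a sum rather than of a module,
  so that it can be supplied even where no hyperedge is available.\<close>

lemma leaf_pole_cancels:
  assumes W: "W = span {\<alpha> e0, \<beta>}" and beta: "\<beta> \<noteq> 0" "\<xi> \<beta> = 0"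
    and h: "h \<in> cohomology G \<alpha>"
    and integral: "\<And>g. g \<in> cohomology (leaf W p) \<alpha> \<Longrightarrow>
      (\<Sum>e\<in>cross_section (leaf W p) \<phi> c. to_quot (f e * rho \<xi> (\<alpha> e) (g (tail G e))) /
        to_quot (sconst (\<xi> (\<alpha> e)) * tangent_product W e)) \<in> range to_quot"
  shows "\<exists>T. \<not> slin \<beta> dvd T \<and>
    (\<Sum>e\<in>cross_section (leaf W p) \<phi> c. to_quot (f e * rho \<xi> (\<alpha> e) (h (tail G e))) /
      to_quot (sconst (\<xi> (\<alpha> e)) * tangent_product UNIV e)) * to_quot T \<in> range to_quot"
proof -
  let ?C = "cross_section (leaf W p) \<phi> c"
  define x where "x e = rho \<xi> (\<alpha> e) (normal_class W (tail G e))" for e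
  have subW: "subspace W" by (simp add: W)
  have C: "e \<in> arcs G" "\<alpha> e \<in> W" "tail G e \<in> verts (leaf W p)" if "e \<in> ?C" for e
    using that by (auto simp: cross_section_def arcs_leaf)
  have fin: "finite ?C"
    using finite_subset[OF _ finite_cross_section[of \<phi> c]] by (auto simp: cross_section_leaf)
  \<comment> \<open>Each \<open>x e\<close> lies in the symmetric algebra of the annihilator of
    \<open>\<xi>\<close>, so the projections along all edges fix it. This lets a single product
    serve for every edge of the component.\<close>
  have x_fixed: "rho \<xi> a (x e) = x e" if "e \<in> ?C" for a e
    using that C by (auto simp: x_def intro!: rho_fixes linear_xi annihilator_rho_edge)
  \<comment> \<open>A normal weight whose projection is divisible by \<open>slin \<beta>\<close>
    would lie in the span of \<open>\<alpha> e\<close> and \<open>\<beta>\<close>, hence in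
    \<open>W\<close>.\<close>
  have "\<not> slin \<beta> dvd x e" if "e \<in> ?C" for e
  proof
    assume "slin \<beta> dvd x e"
    then obtain e' where e': "e' \<in> out_arcs G (tail G e)" "\<alpha> e' \<notin> W"
      "slin \<beta> dvd slin (\<alpha> e' - (\<xi> (\<alpha> e') / \<xi> (\<alpha> e)) *\<^sub>R \<alpha> e)"
      by (auto simp: x_def normal_class_def rho_prod slin_dvd_prod_iff beta rho_slin linear_xi)
    then have "\<alpha> e' - (\<xi> (\<alpha> e') / \<xi> (\<alpha> e)) *\<^sub>R \<alpha> e \<in> span {\<beta>}"
      using beta by (intro slin_dvd_slin)
    then have "\<alpha> e' - (\<xi> (\<alpha> e') / \<xi> (\<alpha> e)) *\<^sub>R \<alpha> e \<in> W"
      unfolding W by (rule subsetD[OF span_mono, rotated]) simp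
    then have "\<alpha> e' - (\<xi> (\<alpha> e') / \<xi> (\<alpha> e)) *\<^sub>R \<alpha> e + (\<xi> (\<alpha> e') / \<xi> (\<alpha> e)) *\<^sub>R \<alpha> e \<in> W"
      using C[OF that] subW by (intro subspace_add subspace_scale)
    with e' show False by simp
  qed
  then have not_dvd: "\<not> slin \<beta> dvd prod x ?C"
    using slin_dvd_prod_iff[OF fin beta(1)] by blast
  obtain \<sigma> where \<sigma>: "\<And>s t. s - t dvd \<sigma> s - \<sigma> t" "\<And>t. t * \<sigma> t = prod x ?C - (\<Prod>e\<in>?C. x e - t)"
    using complementary_product[OF fin] by metis
  \<comment> \<open>Projection along \<open>e\<close> turns the normal class into
    \<open>x e\<close>, at which the subtracted product has a zero factor.\<close>
  have complement: "x e * rho \<xi> (\<alpha> e) (\<sigma> (normal_class W (tail G e))) = prod x ?C" if "e \<in> ?C" for e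
  proof -
    let ?t = "normal_class W (tail G e)"
    have "x e * rho \<xi> (\<alpha> e) (\<sigma> ?t) = rho \<xi> (\<alpha> e) (?t * \<sigma> ?t)"
      by (simp add: rho_mult x_def)
    also have "\<dots> = (\<Prod>e'\<in>?C. rho \<xi> (\<alpha> e) (x e')) - (\<Prod>e'\<in>?C. rho \<xi> (\<alpha> e) (x e') - x e)"
      unfolding \<sigma>(2) rho_diff rho_prod x_def ..
    also have "\<dots> = prod x ?C - (\<Prod>e'\<in>?C. x e' - x e)"
      using x_fixed by simp
    also have "(\<Prod>e'\<in>?C. x e' - x e) = 0"
      using fin that by (auto simp: prod_zero_iff)
    finally show ?thesis by simp
  qed
  \<comment> \<open>One \<open>\<sigma>\<close> serves the whole component and preserves
    congruences, so \<open>?g\<close> is again a class. Testing with it inserts the complementary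
    factors into each term.\<close>
  let ?g = "\<lambda>q\<in>verts (leaf W p). h q * \<sigma> (normal_class W q)"
  have "?g \<in> cohomology (leaf W p) \<alpha>"
    unfolding cohomology_def
  proof (intro CollectI conjI ballI)
    fix e assume "e \<in> arcs (leaf W p)"
    then have e: "e \<in> arcs G" "\<alpha> e \<in> W" "tail G e \<in> verts (leaf W p)"
      by (auto simp: arcs_leaf)
    have "slin (\<alpha> e) dvd \<sigma> (normal_class W (tail G e)) - \<sigma> (normal_class W (head G e))"
      using normal_class_congruent[OF subW e(1,2)] \<sigma>(1) by (rule dvd_trans)
    then show "slin (\<alpha> e) dvd ?g (tail (leaf W p) e) - ?g (head (leaf W p) e)"
      using e head_in_leaf[OF e] cohomologyD[OF h e(1)] by (simp add: dvd_mult_diff_mult)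
  qed simp
  from integral[OF this] have "(\<Sum>e\<in>?C. to_quot (f e * rho \<xi> (\<alpha> e) (h (tail G e)) *
      rho \<xi> (\<alpha> e) (\<sigma> (normal_class W (tail G e)))) /
        to_quot (sconst (\<xi> (\<alpha> e)) * tangent_product W e)) \<in> range to_quot"
    using C by (simp add: rho_mult mult.assoc cong: sum.cong)
  also have "(\<Sum>e\<in>?C. to_quot (f e * rho \<xi> (\<alpha> e) (h (tail G e)) *
      rho \<xi> (\<alpha> e) (\<sigma> (normal_class W (tail G e)))) /
        to_quot (sconst (\<xi> (\<alpha> e)) * tangent_product W e)) =
    (\<Sum>e\<in>?C. to_quot (f e * rho \<xi> (\<alpha> e) (h (tail G e))) /
      to_quot (sconst (\<xi> (\<alpha> e)) * tangent_product UNIV e)) * to_quot (prod x ?C)"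
    unfolding sum_distrib_right
  proof (intro sum.cong refl)
    fix e assume e: "e \<in> ?C"
    have "to_quot (x e) \<noteq> 0"
      using rho_normal_class_neq_0 C[OF e] by (simp add: x_def)
    then show "to_quot (f e * rho \<xi> (\<alpha> e) (h (tail G e)) *
        rho \<xi> (\<alpha> e) (\<sigma> (normal_class W (tail G e)))) /
          to_quot (sconst (\<xi> (\<alpha> e)) * tangent_product W e) =
      to_quot (f e * rho \<xi> (\<alpha> e) (h (tail G e))) /
        to_quot (sconst (\<xi> (\<alpha> e)) * tangent_product UNIV e) * to_quot (prod x ?C)"
      unfolding complement[OF e, symmetric]
      by (simp add: tangent_product_UNIV[OF C(1,2)[OF e]] x_def[symmetric] to_quot_mult)
  qed
  finally show ?thesis
    using not_dvd by blast
qed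

text \<open>The span of \<open>a\<close> and \<open>b\<close> has dimension at most two and contains
  two independent weights, so these span it.\<close>

lemma span_tangent_pair:
  assumes "e \<in> arcs G" "e' \<in> out_arcs G (tail G e)" "e' \<noteq> e" "\<alpha> e \<in> span {a, b}" "\<alpha> e' \<in> span {a, b}"
  shows "span {\<alpha> e, \<alpha> e'} = span {a, b}" "dim (span {\<alpha> e, \<alpha> e'}) = 2"
proof -
  note * = not_in_span_sibling(1,2)[OF assms(1-3)]
  have "dim (span {a, b}) \<le> card {a, b}"
    unfolding dim_span by (rule dim_le_card') simp
  also have "\<dots> \<le> 2" by (simp add: card_insert_if)
  also have "2 = card {\<alpha> e', \<alpha> e}" using *(1) by simp
  finally have "dim (span {a, b}) \<le> card {\<alpha> e', \<alpha> e}" .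
  with *(2) have "span {a, b} \<subseteq> span {\<alpha> e', \<alpha> e}"
    using assms(4,5) by (intro card_ge_dim_independent[of "{\<alpha> e', \<alpha> e}" "span {a, b}"]) auto
  moreover have "span {\<alpha> e', \<alpha> e} \<subseteq> span {a, b}"
    using assms by (intro span_minimal) simp_all
  ultimately show "span {\<alpha> e, \<alpha> e'} = span {a, b}" by (simp add: insert_commute)
  have "dim (span {\<alpha> e', \<alpha> e}) = card {\<alpha> e', \<alpha> e}"
    unfolding dim_span by (rule dim_eq_card_independent[OF *(2)])
  then show "dim (span {\<alpha> e, \<alpha> e'}) = 2" using *(1) by (simp add: insert_commute)
qed

text \<open>Since \<open>\<beta>\<close> need not be a weight, \<open>W\<close> must first be
  recognized as the plane of two edges at one vertex. A cross-section edge and another tangent edge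
  at its tail provide it, and the component is rebased there.\<close>

lemma leaf_integral:
  assumes e0: "e0 \<in> cross_section G \<phi> c" and W: "W = span {\<alpha> e0, \<beta>}"
    and hyp: "\<And>G0 E. hyperedge G \<alpha> \<phi> c G0 E \<Longrightarrow>
      restrict (\<lambda>e\<in>cross_section G \<phi> c. to_quot (f e)) E \<in> cross_module G0 \<alpha> \<xi> \<phi> c"
    and g: "g \<in> cohomology (leaf W (tail G e0)) \<alpha>"
  shows "(\<Sum>e\<in>cross_section (leaf W (tail G e0)) \<phi> c. to_quot (f e * rho \<xi> (\<alpha> e) (g (tail G e))) /
    to_quot (sconst (\<xi> (\<alpha> e)) * tangent_product W e)) \<in> range to_quot"
proof -
  let ?G0 = "leaf W (tail G e0)"
  let ?C = "cross_section ?G0 \<phi> c"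
  have C: "e \<in> arcs G" "\<alpha> e \<in> W" "tail G e \<in> verts ?G0" if "e \<in> ?C" for e
    using that by (auto simp: cross_section_def arcs_leaf)
  \<comment> \<open>If no edge of \<open>?C\<close> has another tangent edge at its tail, there is no hyperedge to appeal to, but
    all tangent products are empty.\<close>
  show ?thesis
  proof (cases "\<exists>e\<in>?C. \<exists>e'\<in>out_arcs G (tail G e) - {e}. \<alpha> e' \<in> W")
    case True
    then obtain e e' where e: "e \<in> ?C" and e': "e' \<in> out_arcs G (tail G e)" "e' \<noteq> e" "\<alpha> e' \<in> W"
      by blast
    have plane: "span {\<alpha> e, \<alpha> e'} = W" "dim (span {\<alpha> e, \<alpha> e'}) = 2"
      using span_tangent_pair[of e e' "\<alpha> e0" \<beta>] C[OF e] e' by (simp_all add: W)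
    have "?G0 = leaf W (tail G e)"
      using leaf_eq[OF _ C(3)[OF e]] by (simp add: W)
    then have "hyperedge G \<alpha> \<phi> c ?G0 ?C"
      unfolding hyperedge_def using plane e e' C[OF e]
      by (intro conjI bexI[of _ "tail G e"] bexI[of _ e] bexI[of _ e']) auto
    from hyp[OF this] have "cross_integral ?G0 \<alpha> \<xi> \<phi> c
        (\<lambda>e. restrict (\<lambda>e\<in>cross_section G \<phi> c. to_quot (f e)) ?C e * to_quot (kirwan ?G0 \<alpha> \<xi> \<phi> c g e))
          \<in> range to_quot"
      using g by (auto simp: cross_module_def)
    also have "cross_integral ?G0 \<alpha> \<xi> \<phi> c
        (\<lambda>e. restrict (\<lambda>e\<in>cross_section G \<phi> c. to_quot (f e)) ?C e * to_quot (kirwan ?G0 \<alpha> \<xi> \<phi> c g e)) =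
      (\<Sum>e\<in>?C. to_quot (f e * rho \<xi> (\<alpha> e) (g (tail G e))) /
        to_quot (sconst (\<xi> (\<alpha> e)) * tangent_product W e))"
      unfolding cross_integral_leaf
      by (intro sum.cong) (auto simp: kirwan_def to_quot_mult cross_section_leaf)
    finally show ?thesis .
  next
    case False
    have "(\<Sum>e\<in>?C. to_quot (f e * rho \<xi> (\<alpha> e) (g (tail G e))) /
        to_quot (sconst (\<xi> (\<alpha> e)) * tangent_product W e)) =
      (\<Sum>e\<in>?C. to_quot (f e * rho \<xi> (\<alpha> e) (g (tail G e)) * sconst (1 / \<xi> (\<alpha> e))))"
    proof (intro sum.cong refl)
      fix e assume e: "e \<in> ?C"
      then have "{e' \<in> out_arcs G (tail G e) - {e}. \<alpha> e' \<in> W} = {}" using False by blast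
      then have "tangent_product W e = 1" unfolding tangent_product_def by (simp only: prod.empty)
      then show "to_quot (f e * rho \<xi> (\<alpha> e) (g (tail G e))) /
          to_quot (sconst (\<xi> (\<alpha> e)) * tangent_product W e) =
        to_quot (f e * rho \<xi> (\<alpha> e) (g (tail G e)) * sconst (1 / \<xi> (\<alpha> e)))"
        using xi_neq_0[OF C(1)[OF e]]
        by (simp add: divide_inverse inverse_to_quot_sconst to_quot_mult)
    qed
    then show ?thesis by (simp flip: to_quot_sum)
  qed
qed

lemma cross_integral_polynomial:
  assumes f: "\<And>e. e \<in> cross_section G \<phi> c \<Longrightarrow> f e \<in> sym_of (annihilator \<xi>)"
    and hyp: "\<And>G0 E. hyperedge G \<alpha> \<phi> c G0 E \<Longrightarrow>
      restrict (\<lambda>e\<in>cross_section G \<phi> c. to_quot (f e)) E \<in> cross_module G0 \<alpha> \<xi> \<phi> c"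
    and h: "h \<in> cohomology G \<alpha>"
  shows "(\<Sum>e\<in>cross_section G \<phi> c. to_quot (f e * rho \<xi> (\<alpha> e) (h (tail G e))) /
    to_quot (sconst (\<xi> (\<alpha> e)) * tangent_product UNIV e)) \<in> to_quot ` sym_of (annihilator \<xi>)"
\<comment> \<open>A nonempty cross-section provides the edge whose projection is used at the end; an
  empty one gives the sum zero.\<close>
proof (cases "cross_section G \<phi> c = {}")
  case False
  let ?V = "cross_section G \<phi> c"
  define t where "t e = to_quot (f e * rho \<xi> (\<alpha> e) (h (tail G e))) /
    to_quot (sconst (\<xi> (\<alpha> e)) * tangent_product UNIV e)" for e
  \<comment> \<open>These are the linear factors of all denominators, one for each cross-section
    edge and sibling, repetitions included. Their product \<open>D\<close> is a common denominator
    up to constants.\<close>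
  define b where "b = (\<lambda>(e, e'). \<alpha> e' - (\<xi> (\<alpha> e') / \<xi> (\<alpha> e)) *\<^sub>R \<alpha> e)"
  define I where "I = (SIGMA e:?V. out_arcs G (tail G e) - {e})"
  define D where "D = (\<Prod>i\<in>I. slin (b i))"
  have V: "e \<in> arcs G" "tail G e \<in> verts G" if "e \<in> ?V" for e
    using that by (auto simp: cross_section_def)
  have finI: "finite I"
    unfolding I_def by (intro finite_SigmaI finite_cross_section) (simp add: out_arcs_def)
  have D_eq: "D = (\<Prod>e\<in>?V. tangent_product UNIV e)"
    unfolding D_def I_def b_def tangent_product_UNIV_eq
    by (subst prod.Sigma) (auto simp: finite_cross_section out_arcs_def rho_slin linear_xi intro!: prod.cong)
  have b: "b i \<noteq> 0" "\<xi> (b i) = 0" if "i \<in> I" for i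
  proof -
    obtain e e' where i: "i = (e, e')" "e \<in> ?V" "e' \<in> out_arcs G (tail G e)" "e' \<noteq> e"
      using \<open>i \<in> I\<close> unfolding I_def by (elim SigmaE) blast
    have "slin (b i) \<noteq> 0"
      using rho_sibling_neq_0[of e e'] i V[OF i(2)] by (simp add: b_def rho_slin linear_xi)
    then show "b i \<noteq> 0" by auto
    show "\<xi> (b i) = 0"
      using i xi_neq_0[OF V(1)[OF i(2)]] by (simp add: b_def linear_diff linear_cmul linear_xi)
  qed
  have D_neq_0: "D \<noteq> 0"
    using tangent_product_neq_0 V by (auto simp: D_eq finite_cross_section)
  have tangent_in: "tangent_product UNIV e \<in> sym_of (annihilator \<xi>)" if "e \<in> ?V" for e
    unfolding tangent_product_def using that V by (intro sym_of_prod annihilator_rho_edge)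
  have D_in: "D \<in> sym_of (annihilator \<xi>)"
    unfolding D_eq by (intro sym_of_prod tangent_in)
  \<comment> \<open>Recording that the numerators lie in the symmetric algebra of the annihilator
    serves at the end to place \<open>P\<close> there too.\<close>
  have "\<exists>N\<in>sym_of (annihilator \<xi>). t e * to_quot D = to_quot N" if e: "e \<in> ?V" for e
  proof
    let ?N = "f e * rho \<xi> (\<alpha> e) (h (tail G e)) * sconst (1 / \<xi> (\<alpha> e)) *
      (\<Prod>e'\<in>?V - {e}. tangent_product UNIV e')"
    show "?N \<in> sym_of (annihilator \<xi>)"
      using e V f by (intro sym_of.mult sym_of.const sym_of_prod tangent_in annihilator_rho_edge) auto
    have "D = tangent_product UNIV e * (\<Prod>e'\<in>?V - {e}. tangent_product UNIV e')"
      unfolding D_eq using e by (intro prod.remove finite_cross_section)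
    moreover have "to_quot (tangent_product UNIV e) \<noteq> 0"
      using tangent_product_neq_0 V e by simp
    moreover have "inverse (to_quot (sconst (\<xi> (\<alpha> e)) :: 'n sym)) = to_quot (sconst (1 / \<xi> (\<alpha> e)))"
      using xi_neq_0[OF V(1)[OF e]] by (rule inverse_to_quot_sconst)
    ultimately show "t e * to_quot D = to_quot ?N"
      by (simp add: t_def to_quot_mult divide_inverse)
  qed
  then obtain N where N: "\<And>e. e \<in> ?V \<Longrightarrow> N e \<in> sym_of (annihilator \<xi>)"
      "\<And>e. e \<in> ?V \<Longrightarrow> t e * to_quot D = to_quot (N e)"
    by metis
  have sumN: "sum t ?V * to_quot D = to_quot (sum N ?V)"
    by (simp add: sum_distrib_right to_quot_sum N(2))
  have "sum t ?V \<in> range to_quot"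
  proof (rule no_poles[of I b])
    fix i assume i: "i \<in> I"
    \<comment> \<open>With the pole \<open>b i\<close> fixed, each edge determines a span and a
      component; the sum is split along the fibres of \<open>cl\<close>.\<close>
    define W where "W e = span {\<alpha> e, b i}" for e
    define cl where "cl e = leaf (W e) (tail G e)" for e
    \<comment> \<open>As \<open>\<xi> (b i) = 0\<close> while \<open>\<xi>\<close> vanishes on no edge, the plane of an edge is spanned by \<open>b i\<close> and
      any cross-section edge in it, so the components partition \<open>?V\<close>.\<close>
    have same_leaf: "{e \<in> ?V. cl e = cl e0} = cross_section (cl e0) \<phi> c" if e0: "e0 \<in> ?V" for e0
    proof (intro equalityI subsetI)
      fix e assume "e \<in> {e \<in> ?V. cl e = cl e0}"
      then have e: "e \<in> ?V" "cl e = cl e0" by auto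
      have "e \<in> cross_section (cl e) \<phi> c"
        unfolding cl_def cross_section_leaf
        using e(1) self_in_leaf[OF V(2)[OF e(1)]] by (simp add: W_def span_base)
      with e(2) show "e \<in> cross_section (cl e0) \<phi> c" by simp
    next
      fix e assume "e \<in> cross_section (cl e0) \<phi> c"
      then have e: "e \<in> ?V" "\<alpha> e \<in> W e0" "tail G e \<in> verts (leaf (W e0) (tail G e0))"
        by (auto simp: cl_def cross_section_leaf)
      from e(2) obtain k where k: "\<alpha> e - k *\<^sub>R \<alpha> e0 \<in> span {b i}"
        unfolding W_def by (auto dest: span_breakdown_eq[THEN iffD1])
      \<comment> \<open>Pairing with \<open>\<xi>\<close> gives
        \<open>\<xi> (\<alpha> e) = k * \<xi> (\<alpha> e0)\<close> with nonzero left side. So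
        \<open>k\<close> is invertible and the roles of \<open>e\<close> and \<open>e0\<close> can
        be exchanged.\<close>
      then have "\<xi> (\<alpha> e - k *\<^sub>R \<alpha> e0) = 0"
        using b(2)[OF i] by (auto simp: span_singleton linear_cmul linear_xi)
      then have "k \<noteq> 0"
        using xi_neq_0[OF V(1)[OF e(1)]] by auto
      have "\<alpha> e - (\<alpha> e - k *\<^sub>R \<alpha> e0) \<in> W e"
        unfolding W_def
        by (intro span_diff span_base subsetD[OF span_mono k, rotated]) auto
      then have "(1 / k) *\<^sub>R (\<alpha> e - (\<alpha> e - k *\<^sub>R \<alpha> e0)) \<in> W e"
        unfolding W_def by (rule span_scale)
      with \<open>k \<noteq> 0\<close> have "\<alpha> e0 \<in> W e" by simp
      with e(2) have "W e = W e0"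
        unfolding W_def by (intro equalityI span_minimal) (auto intro: span_base)
      then have "cl e = cl e0"
        using leaf_eq[OF _ e(3)] by (simp add: cl_def W_def)
      with e(1) show "e \<in> {e \<in> ?V. cl e = cl e0}" by simp
    qed
    have "\<exists>T. \<not> slin (b i) dvd T \<and> sum t {e \<in> ?V. cl e = K} * to_quot T \<in> range to_quot"
      if "K \<in> cl ` ?V" for K
    proof -
      obtain e0 where e0: "e0 \<in> ?V" "K = leaf (W e0) (tail G e0)"
        using \<open>K \<in> cl ` ?V\<close> by (auto simp: cl_def)
      show ?thesis
        unfolding e0(2) same_leaf[OF e0(1), unfolded cl_def[of e0]] t_def
        by (rule leaf_pole_cancels[OF W_def b[OF i] h leaf_integral[OF e0(1) W_def hyp]])
    qed
    then have "\<exists>T. \<forall>K\<in>cl ` ?V. \<not> slin (b i) dvd T K \<and>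
        sum t {e \<in> ?V. cl e = K} * to_quot (T K) \<in> range to_quot"
      by (intro bchoice ballI)
    then obtain T where T: "\<And>K. K \<in> cl ` ?V \<Longrightarrow> \<not> slin (b i) dvd T K"
      "\<And>K. K \<in> cl ` ?V \<Longrightarrow> sum t {e \<in> ?V. cl e = K} * to_quot (T K) \<in> range to_quot"
      by blast
    have fin: "finite (cl ` ?V)" by (simp add: finite_cross_section)
    \<comment> \<open>One multiplier must serve all components at once: the product of the
      individual ones is still prime to \<open>b i\<close>, and in each group the other factors are
      polynomial.\<close>
    have "\<not> slin (b i) dvd prod T (cl ` ?V)"
      using T(1) slin_dvd_prod_iff[OF fin b(1)[OF i]] by blast
    moreover have "sum t ?V * to_quot (prod T (cl ` ?V)) \<in> range to_quot"
    proof -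
      have "sum t ?V * to_quot (prod T (cl ` ?V)) =
          (\<Sum>K\<in>cl ` ?V. sum t {e \<in> ?V. cl e = K} * to_quot (T K) * to_quot (prod T (cl ` ?V - {K})))"
        unfolding sum.image_gen[OF finite_cross_section, of t \<phi> c cl] sum_distrib_right[of _ "cl ` ?V"]
      proof (intro sum.cong refl)
        fix K assume "K \<in> cl ` ?V"
        then have "prod T (cl ` ?V) = T K * prod T (cl ` ?V - {K})" by (rule prod.remove[OF fin])
        then show "sum t {e \<in> ?V. cl e = K} * to_quot (prod T (cl ` ?V)) =
            sum t {e \<in> ?V. cl e = K} * to_quot (T K) * to_quot (prod T (cl ` ?V - {K}))"
          by (simp add: to_quot_mult)
      qed
      also have "\<dots> \<in> range to_quot"
      proof -
        have "\<exists>S. \<forall>K\<in>cl ` ?V. sum t {e \<in> ?V. cl e = K} * to_quot (T K) = to_quot (S K)"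
          using T(2) by (intro bchoice ballI) blast
        then obtain S where "\<And>K. K \<in> cl ` ?V \<Longrightarrow>
            sum t {e \<in> ?V. cl e = K} * to_quot (T K) = to_quot (S K)"
          by blast
        then show ?thesis by (simp flip: to_quot_mult to_quot_sum)
      qed
      finally show ?thesis .
    qed
    ultimately show "\<exists>T. \<not> slin (b i) dvd T \<and> sum t ?V * to_quot T \<in> range to_quot" by blast
  qed (use finI b sumN in \<open>simp_all add: D_def\<close>)
  then obtain P where P: "sum t ?V = to_quot P" by auto
  have PD: "P * D = sum N ?V"
    using sumN by (simp add: P flip: to_quot_mult)
  \<comment> \<open>\<open>P\<close> is so far only a polynomial on the whole space; the projection \<open>rho\<close> fixes
    \<open>D\<close> and \<open>P * D\<close>, hence \<open>P\<close>.\<close>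
  from False obtain e where e: "e \<in> ?V" by auto
  have "rho \<xi> (\<alpha> e) P * D = rho \<xi> (\<alpha> e) (P * D)"
    using D_in by (simp add: rho_mult rho_fixes linear_xi)
  also have "\<dots> = P * D"
    unfolding PD using N(1) by (intro rho_fixes linear_xi sym_of_sum)
  finally have "rho \<xi> (\<alpha> e) P * D = P * D" .
  then have "P \<in> sym_of (annihilator \<xi>)"
    using D_neq_0 annihilator_rho_edge[OF V(1)[OF e], of P] by simp
  then show ?thesis using P by (simp add: t_def)
qed (use image_eqI[of 0 to_quot 0] in simp)

end

theorem theorem5p1:
  fixes G :: "('a, 'b) pre_digraph" and arev :: "'b \<Rightarrow> 'b" and d :: nat
    and \<alpha> :: "'b \<Rightarrow> 'n::{finite,linorder} weight"
    and \<xi> :: "'n weight \<Rightarrow> real" and \<phi> :: "'a \<Rightarrow> real" and c :: real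
    and f :: "'b \<Rightarrow> 'n sym"
  assumes "CARD('n) > 1"
    and "one_skeleton G arev d \<alpha>"
    and "linear \<xi>"
    and "generic G \<alpha> \<xi>" and "polarizing G \<alpha> \<xi>" and "xi_acyclic G \<alpha> \<xi>"
    and "inj_on \<phi> (verts G)" and "xi_compatible G \<alpha> \<xi> \<phi>"
    and "c \<notin> \<phi> ` verts G"
    and "f \<in> cross_section G \<phi> c \<rightarrow>\<^sub>E sym_of (annihilator \<xi>)"
  shows "(\<lambda>e\<in>cross_section G \<phi> c. to_quot (f e)) \<in> cross_module G \<alpha> \<xi> \<phi> c \<longleftrightarrow>
    (\<forall>G0 E. hyperedge G \<alpha> \<phi> c G0 E \<longrightarrow>
       restrict (\<lambda>e\<in>cross_section G \<phi> c. to_quot (f e)) E \<in> cross_module G0 \<alpha> \<xi> \<phi> c)"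
proof -
  interpret one_skeleton G arev d \<alpha> by fact
  interpret polarized_one_skeleton G arev d \<alpha> \<xi>
    by (intro polarized_one_skeleton.intro polarized_one_skeleton_axioms.intro) fact+
  let ?F = "\<lambda>e\<in>cross_section G \<phi> c. to_quot (f e)"
  have f: "f e \<in> sym_of (annihilator \<xi>)" if "e \<in> cross_section G \<phi> c" for e
    using assms(10) that by blast
  show ?thesis
  proof (intro iffI allI impI)
    fix G0 E
    assume F: "?F \<in> cross_module G \<alpha> \<xi> \<phi> c" and "hyperedge G \<alpha> \<phi> c G0 E"
    then obtain p e1 e2 where "G0 = leaf (span {\<alpha> e1, \<alpha> e2}) p" "E = cross_section G0 \<phi> c"
      by (auto simp: hyperedge_def)
    then show "restrict ?F E \<in> cross_module G0 \<alpha> \<xi> \<phi> c"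
      using cross_module_leaf[OF subspace_span F] by simp
  next
    assume hyp: "\<forall>G0 E. hyperedge G \<alpha> \<phi> c G0 E \<longrightarrow> restrict ?F E \<in> cross_module G0 \<alpha> \<xi> \<phi> c"
    have "cross_integral G \<alpha> \<xi> \<phi> c (\<lambda>e. ?F e * to_quot (kirwan G \<alpha> \<xi> \<phi> c h e))
        \<in> to_quot ` sym_of (annihilator \<xi>)" if "h \<in> cohomology G \<alpha>" for h
    proof -
      have "cross_integral G \<alpha> \<xi> \<phi> c (\<lambda>e. ?F e * to_quot (kirwan G \<alpha> \<xi> \<phi> c h e)) =
          (\<Sum>e\<in>cross_section G \<phi> c. to_quot (f e * rho \<xi> (\<alpha> e) (h (tail G e))) /
            to_quot (sconst (\<xi> (\<alpha> e)) * tangent_product UNIV e))"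
        unfolding cross_integral_UNIV by (intro sum.cong) (simp_all add: kirwan_def to_quot_mult)
      then show ?thesis
        using cross_integral_polynomial[OF f hyp[rule_format] that] by simp
    qed
    then show "?F \<in> cross_module G \<alpha> \<xi> \<phi> c"
      unfolding cross_module_def using f by (auto intro: to_quot_in_quot_of)
  qed
qed

end
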